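(* Let $X$ be a Banach space, $(A_n)_{n\in\mathbb N}$ a sequence in $\mathcal B(X)$, $\mu=(\mu_n)_{n\in\mathbb N}$ a growth rate and $\nu=(\nu_n)_{n\in\mathbb N}$ a sequence with $\nu_n\ge 1$ for all $n$. Let $(\gamma_n)_{n\in\mathbb N}$ be a sequence with $\gamma_n>0$ for every $n\in\mathbb N$ and $\sum_{n=0}^\infty\gamma_n<+\infty$. Suppose that $x_{n+1}=A_nx_n$, $n\in\mathbb N$, admits a $(\mu,\nu)$-dichotomy with exponent $\lambda>0$, that there exists $\varepsilon\in[0,\lambda)$ with $\sup_{n\in\mathbb N}(\mu_n^{-\varepsilon}\nu_n)<+\infty$, and take $\beta\in(0,\lambda-\varepsilon)$. Then there exists $c_0>0$ such that, for every $c\in(0,c_0]$ and every sequence $(B_n)_{n\in\mathbb N}$ in $\mathcal B(X)$ satisfying \[\|B_n\|\le\frac{c\,\gamma_n\,\mu_n^\beta}{\nu_{n+1}\,\mu_{n+1}^\beta},\quad n\in\mathbb N,\] the equation $x_{n+1}=(A_n+B_n)x_n$, $n\in\mathbb N$, also admits a $(\mu,\nu)$-dichotomy.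
   Context: $\mathbb N=\{0,1,2,\dots\}$. $(X,\|\cdot\|)$ is a Banach space and $\mathcal B(X)$ is the space of bounded linear operators on $X$ with the operator norm. A growth rate $\mu=(\mu_n)_{n\in\mathbb N}$ is a strictly increasing sequence of positive numbers with $\lim_{n\to+\infty}\mu_n=+\infty$. For $m\ge n$, $\mathcal A(m,n)=A_{m-1}\cdots A_n$ if $m>n$ and $\mathcal A(n,n)=\mathrm{Id}$. $(\mu,\nu)$-dichotomy: the equation $x_{n+1}=A_nx_n$, $n\in\mathbb N$, admits a $(\mu,\nu)$-dichotomy if (1) there are projections $P_n$ on $X$, $n\in\mathbb N$, with $A_nP_n=P_{n+1}A_n$ for all $n$; (2) $A_n|_{\operatorname{Ker}P_n}:\operatorname{Ker}P_n\to\operatorname{Ker}P_{n+1}$ is invertible for all $n$; (3) there exist $D,\lambda>0$ ($\lambda$ is called the exponent) such that $\|\mathcal A(m,n)P_n\|\le D\nu_n(\mu_m/\mu_n)^{-\lambda}$ for $m\ge n$ and $\|\mathcal A(m,n)(\mathrm{Id}-P_n)\|\le D\nu_n(\mu_n/\mu_m)^{-\lambda}$ for $m\le n$, where for $m\le n$ one sets $\mathcal A(m,n):=(\mathcal A(n,m)|_{\operatorname{Ker}P_m})^{-1}:\operatorname{Ker}P_n\to\operatorname{Ker}P_m$. The projections and the constants $D,\lambda$ for the perturbed equation may differ from those of the original one. *)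

theory Defs
  imports "HOL-Analysis.Analysis"
begin

definition growth_rate :: "(nat \<Rightarrow> real) \<Rightarrow> bool" where
  "growth_rate \<mu> \<longleftrightarrow> strict_mono \<mu> \<and> (\<forall>n. 0 < \<mu> n) \<and> filterlim \<mu> at_top sequentially"

text \<open>\<open>evol A m n\<close> is \<open>A (m - 1) \<cdots> A n\<close> for \<open>n < m\<close> and the identity for \<open>m = n\<close>.
  It is only used for \<open>n \<le> m\<close>; the value \<open>id_blinfun\<close> for \<open>m < n\<close> is a dummy.\<close>

primrec evol ::
  "(nat \<Rightarrow> 'a::real_normed_vector \<Rightarrow>\<^sub>L 'a) \<Rightarrow> nat \<Rightarrow> nat \<Rightarrow> 'a \<Rightarrow>\<^sub>L 'a" where
  "evol A 0 n = id_blinfun"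
| "evol A (Suc m) n = (if n \<le> m then A m o\<^sub>L evol A m n else id_blinfun)"

definition ker :: "('a::real_normed_vector \<Rightarrow>\<^sub>L 'a) \<Rightarrow> 'a set" where
  "ker P = {x. blinfun_apply P x = 0}"

text \<open>For \<open>m \<le> n\<close>: the inverse of the restriction of \<open>evol A n m\<close> to \<open>ker (P m)\<close>,
  to be applied to elements of \<open>ker (P n)\<close> only.\<close>

definition evol_back ::
  "(nat \<Rightarrow> 'a::real_normed_vector \<Rightarrow>\<^sub>L 'a) \<Rightarrow> (nat \<Rightarrow> 'a \<Rightarrow>\<^sub>L 'a) \<Rightarrow> nat \<Rightarrow> nat \<Rightarrow> 'a \<Rightarrow> 'a" where
  "evol_back A P m n = inv_into (ker (P m)) (blinfun_apply (evol A n m))"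

text \<open>The operators \<open>evol_back A P m n \<circ> (id_blinfun - P n)\<close> are not elements of the type of
  bounded operators, so their norm is taken with \<open>onorm\<close>. As \<open>onorm\<close> is a supremum of reals, with
  an unspecified value on unbounded sets, boundedness is stated along with the estimate; on a
  Banach space it is automatic by the open mapping theorem.\<close>

definition dichotomy_with_exponent ::
  "(nat \<Rightarrow> real) \<Rightarrow> (nat \<Rightarrow> real) \<Rightarrow> (nat \<Rightarrow> 'a::banach \<Rightarrow>\<^sub>L 'a) \<Rightarrow> real \<Rightarrow> bool" where
  "dichotomy_with_exponent \<mu> \<nu> A lam \<longleftrightarrow> 0 < lam \<and>
     (\<exists>P :: nat \<Rightarrow> 'a \<Rightarrow>\<^sub>L 'a.
        (\<forall>n. P n o\<^sub>L P n = P n) \<and>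
        (\<forall>n. A n o\<^sub>L P n = P (Suc n) o\<^sub>L A n) \<and>
        (\<forall>n. bij_betw (blinfun_apply (A n)) (ker (P n)) (ker (P (Suc n)))) \<and>
        (\<exists>D>0.
           (\<forall>m n. n \<le> m \<longrightarrow>
              norm (evol A m n o\<^sub>L P n) \<le> D * \<nu> n * (\<mu> m / \<mu> n) powr (- lam)) \<and>
           (\<forall>m n. m \<le> n \<longrightarrow>
              bounded_linear (\<lambda>x. evol_back A P m n (blinfun_apply (id_blinfun - P n) x)) \<and>
              onorm (\<lambda>x. evol_back A P m n (blinfun_apply (id_blinfun - P n) x))
                \<le> D * \<nu> n * (\<mu> n / \<mu> m) powr (- lam))))"

definition admits_dichotomy ::
  "(nat \<Rightarrow> real) \<Rightarrow> (nat \<Rightarrow> real) \<Rightarrow> (nat \<Rightarrow> 'a::banach \<Rightarrow>\<^sub>L 'a) \<Rightarrow> bool" where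
  "admits_dichotomy \<mu> \<nu> A \<longleftrightarrow> (\<exists>lam. dichotomy_with_exponent \<mu> \<nu> A lam)"

end

theory Submission
  imports Defs
begin

text \<open>Let \<open>G m n\<close> be the Green function of the unperturbed equation: \<open>A(m, n) P\<^sub>n\<close> for \<open>n \<le> m\<close>
  and \<open>- A(m, n) (Id - P\<^sub>n)\<close> for \<open>m < n\<close>. The Green function \<open>G'\<close> of the perturbed equation is the
  solution of \<open>G' m n = G m n + (\<Sum>k. G m (k + 1) B\<^sub>k G' k n)\<close>. In the norm with weight
  \<open>exp (- \<beta> \<bar>ln \<mu>\<^sub>m - ln \<mu>\<^sub>n\<bar>)\<close> the right-hand side is a contraction for small \<open>c\<close>, because the
  factor \<open>(\<mu>\<^sub>k / \<mu>\<^bsub>k+1\<^esub>)\<^sup>\<beta>\<close> in the bound on \<open>B\<^sub>k\<close> pays for the step from \<open>k\<close> to \<open>k + 1\<close> in the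
  triangle inequality for \<open>\<bar>ln \<mu>\<^sub>m - ln \<mu>\<^sub>n\<bar>\<close>, and \<open>\<nu>\<^bsub>k+1\<^esub>\<close> cancels. Hence \<open>G'\<close> decays with
  exponent \<open>\<beta>\<close>, and \<open>P'\<^sub>n = G' n n\<close> are the new projections. Idempotency holds because
  \<open>G' m n P'\<^sub>n - [n \<le> m] G' m n\<close> is a decaying solution of the homogeneous perturbed equation whose
  initial value lies in the kernel of \<open>P\<^sub>0\<close>; summation by parts, whose boundary term vanishes
  because \<open>\<nu>\<^sub>n\<close> grows slower than \<open>\<mu>\<^sub>n\<close> to the power \<open>\<lambda>\<close>, makes it a fixed point of the linear part
  of the contraction.\<close>

section \<open>The algebra of bounded operators under composition\<close>

lemma blinfun_compose_assoc: "(f o\<^sub>L g) o\<^sub>L h = f o\<^sub>L (g o\<^sub>L h)"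
  by (rule blinfun_eqI) simp

lemma blinfun_compose_id [simp]: "f o\<^sub>L id_blinfun = f" "id_blinfun o\<^sub>L f = f"
  by (rule blinfun_eqI, simp)+

lemmas blinfun_compose_bilinear =
  bounded_bilinear.add_left[OF bounded_bilinear_blinfun_compose]
  bounded_bilinear.add_right[OF bounded_bilinear_blinfun_compose]
  bounded_bilinear.diff_left[OF bounded_bilinear_blinfun_compose]
  bounded_bilinear.diff_right[OF bounded_bilinear_blinfun_compose]

lemmas bounded_linear_compose_left =
  bounded_bilinear.bounded_linear_left[OF bounded_bilinear_blinfun_compose]

lemmas bounded_linear_compose_right =
  bounded_bilinear.bounded_linear_right[OF bounded_bilinear_blinfun_compose]

section \<open>Summable kernels on weighted spaces of sequences of operators\<close>

text \<open>The bound \<open>a k\<close> is uniform in the row \<open>m\<close>. Hence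
  \<open>F \<mapsto> (\<lambda>m. \<Sum>k. K m k o\<^sub>L F k)\<close> is a contraction with
  constant \<open>suminf a\<close> for the norm given by the supremum of
  \<open>norm (F m) / w m\<close>.\<close>

locale summable_kernel =
  fixes K :: "nat \<Rightarrow> nat \<Rightarrow> 'a::banach \<Rightarrow>\<^sub>L 'a" and w a :: "nat \<Rightarrow> real"
  assumes weight_pos: "0 < w m"
    and kernel_le: "norm (K m k) * w k \<le> a k * w m"
    and summable_a: "summable a"
    and suminf_a: "suminf a < 1"
begin

lemma a_nonneg: "0 \<le> a k"
proof -
  have "0 \<le> norm (K k k) * w k"
    using weight_pos[of k] by simp
  also have "\<dots> \<le> a k * w k"
    by (rule kernel_le)
  finally show ?thesis
    using weight_pos[of k] by (simp add: zero_le_mult_iff)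
qed

lemma suminf_nonneg_a: "0 \<le> suminf a"
  using summable_a a_nonneg by (rule suminf_nonneg)

lemma norm_compose_le:
  assumes "\<And>k. norm (F k) \<le> C * w k" "0 \<le> C"
  shows "norm (K m k o\<^sub>L F k) \<le> C * w m * a k"
proof -
  have "norm (K m k o\<^sub>L F k) \<le> norm (K m k) * norm (F k)"
    by (rule norm_blinfun_compose)
  also have "\<dots> \<le> norm (K m k) * (C * w k)"
    by (intro mult_left_mono assms) simp
  also have "\<dots> = C * (norm (K m k) * w k)"
    by simp
  also have "\<dots> \<le> C * (a k * w m)"
    by (intro mult_left_mono kernel_le assms)
  finally show ?thesis
    by (simp add: mult_ac)
qed

lemma summable_compose:
  assumes "\<And>k. norm (F k) \<le> C * w k" "0 \<le> C"
  shows "summable (\<lambda>k. K m k o\<^sub>L F k)"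
  by (rule summable_comparison_test'[OF summable_mult[OF summable_a]]) (rule norm_compose_le[OF assms])

lemma norm_suminf_compose_le:
  assumes "\<And>k. norm (F k) \<le> C * w k" "0 \<le> C"
  shows "norm (\<Sum>k. K m k o\<^sub>L F k) \<le> C * suminf a * w m"
proof -
  have "norm (\<Sum>k. K m k o\<^sub>L F k) \<le> (\<Sum>k. C * w m * a k)"
    by (intro norm_suminf_le norm_compose_le assms summable_mult summable_a)
  also have "\<dots> = C * suminf a * w m"
    using suminf_mult[OF summable_a] by simp
  finally show ?thesis .
qed

text \<open>Uniqueness of fixed points: each use of the equation gains a factor
  \<open>suminf a < 1\<close> in the bound on \<open>H\<close>.\<close>

lemma fixed_point_eq_0:
  assumes bound: "\<And>m. norm (H m) \<le> C * w m"
    and fp: "\<And>m. H m = (\<Sum>k. K m k o\<^sub>L H k)"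
  shows "H m = 0"
proof -
  have "0 \<le> C * w 0"
    using bound[of 0] norm_ge_zero order_trans by blast
  then have C: "0 \<le> C"
    using weight_pos[of 0] by (simp add: zero_le_mult_iff)
  have le: "norm (H m) \<le> C * suminf a ^ j * w m" for j m
  proof (induction j arbitrary: m)
    case 0
    then show ?case using bound by simp
  next
    case (Suc j)
    have "norm (H m) \<le> C * suminf a ^ j * suminf a * w m"
      unfolding fp[of m]
      by (rule norm_suminf_compose_le[OF Suc]) (simp add: C suminf_nonneg_a)
    then show ?case by (simp add: mult_ac)
  qed
  have "(\<lambda>j. suminf a ^ j) \<longlonglongrightarrow> 0"
    using suminf_nonneg_a suminf_a by (rule LIMSEQ_realpow_zero)
  then have "(\<lambda>j. C * suminf a ^ j * w m) \<longlonglongrightarrow> C * 0 * w m"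
    by (intro tendsto_mult tendsto_const)
  then have "norm (H m) \<le> C * 0 * w m"
    by (rule LIMSEQ_le_const) (use le in blast)
  then show ?thesis by simp
qed

text \<open>The solution is the Neumann series: \<open>h j\<close> is the kernel applied
  \<open>j\<close> times to \<open>g\<close>, and its size is at most \<open>M * q ^ j\<close> times
  the weight.\<close>

lemma fixed_point_exists:
  fixes g :: "nat \<Rightarrow> 'a \<Rightarrow>\<^sub>L 'a"
  assumes g: "\<And>m. norm (g m) \<le> M * w m"
  obtains F where "\<And>m. norm (F m) \<le> M / (1 - suminf a) * w m"
    and "\<And>m. F m = g m + (\<Sum>k. K m k o\<^sub>L F k)"
proof -
  have "0 \<le> M * w 0"
    using g[of 0] norm_ge_zero order_trans by blast
  then have M: "0 \<le> M"
    using weight_pos[of 0] by (simp add: zero_le_mult_iff)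
  define q where "q = suminf a"
  have q: "0 \<le> q" "q < 1"
    using suminf_nonneg_a suminf_a by (auto simp: q_def)
  define h where "h = rec_nat g (\<lambda>_ f m. \<Sum>k. K m k o\<^sub>L f k)"
  have h_0: "h 0 = g" and h_Suc: "h (Suc j) = (\<lambda>m. \<Sum>k. K m k o\<^sub>L h j k)" for j
    by (simp_all add: h_def)
  have h_le: "norm (h j m) \<le> M * q ^ j * w m" for j m
  proof (induction j arbitrary: m)
    case 0
    then show ?case using g by (simp add: h_0)
  next
    case (Suc j)
    have "norm (h (Suc j) m) \<le> M * q ^ j * suminf a * w m"
      unfolding h_Suc by (rule norm_suminf_compose_le[OF Suc]) (simp add: M q)
    then show ?case by (simp add: q_def mult_ac)
  qed
  have geo: "(\<lambda>j. M * q ^ j * w m) sums (M / (1 - q) * w m)" for m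
    using sums_mult2[OF sums_mult[OF geometric_sums[of q]], of M "w m"] q by simp
  have h_summable: "summable (\<lambda>j. h j m)" for m
    using h_le by (intro summable_comparison_test'[OF sums_summable[OF geo[of m]]]) auto
  define F where "F m = (\<Sum>j. h j m)" for m
  have F_le: "norm (F m) \<le> M / (1 - q) * w m" for m
    unfolding F_def sums_unique[OF geo[of m]]
    by (intro norm_suminf_le h_le sums_summable[OF geo])
  have MC: "0 \<le> M / (1 - q)"
    using M q by simp
  have tail_le: "norm (F m - (\<Sum>j<J. h j m)) \<le> M / (1 - q) * q ^ J * w m" for m J
  proof -
    have "F m - (\<Sum>j<J. h j m) = (\<Sum>j. h (j + J) m)"
      unfolding F_def using suminf_split_initial_segment[OF h_summable, of m J] by simp
    also have "norm \<dots> \<le> (\<Sum>j. M * q ^ j * w m * q ^ J)"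
    proof (rule norm_suminf_le)
      show "norm (h (j + J) m) \<le> M * q ^ j * w m * q ^ J" for j
        using h_le[of "j + J" m] by (simp add: power_add mult_ac)
      show "summable (\<lambda>j. M * q ^ j * w m * q ^ J)"
        using sums_summable[OF geo] by (rule summable_mult2)
    qed
    also have "\<dots> = M / (1 - q) * w m * q ^ J"
      using sums_unique[OF sums_mult2[OF geo]] by simp
    finally show ?thesis by (simp add: mult_ac)
  qed
  have F_eq: "F m = g m + (\<Sum>k. K m k o\<^sub>L F k)" for m
  proof -
    \<comment> \<open>Partial sums avoid interchanging two infinite series: the kernel commutes with
      finite sums, and \<open>tail_le\<close> controls the remainder as \<open>J\<close>
      grows.\<close>
    have sum_eq: "(\<Sum>k. K m k o\<^sub>L (\<Sum>j<J. h j k)) = (\<Sum>j<J. h (Suc j) m)" for J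
    proof -
      have "(\<lambda>k. \<Sum>j<J. K m k o\<^sub>L h j k) sums (\<Sum>j<J. h (Suc j) m)"
        unfolding h_Suc
        by (intro sums_sum summable_sums summable_compose[OF h_le]) (simp add: M q)
      then show ?thesis
        by (simp add: sums_iff bounded_bilinear.sum_right[OF bounded_bilinear_blinfun_compose])
    qed
    have le: "norm ((\<Sum>k. K m k o\<^sub>L F k) - (\<Sum>j<J. h (Suc j) m)) \<le> M / (1 - q) * q * w m * q ^ J" for J
    proof -
      have sF: "summable (\<lambda>k. K m k o\<^sub>L F k)"
        using F_le MC by (rule summable_compose)
      have tail: "summable (\<lambda>k. K m k o\<^sub>L (F k - (\<Sum>j<J. h j k)))"
        using tail_le by (rule summable_compose) (intro mult_nonneg_nonneg MC zero_le_power q)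
      have "(\<Sum>k. K m k o\<^sub>L F k) - (\<Sum>k. K m k o\<^sub>L (F k - (\<Sum>j<J. h j k)))
          = (\<Sum>k. K m k o\<^sub>L (\<Sum>j<J. h j k))"
        using suminf_diff[OF sF tail] by (simp add: blinfun_compose_bilinear)
      then have "(\<Sum>k. K m k o\<^sub>L F k) - (\<Sum>j<J. h (Suc j) m)
          = (\<Sum>k. K m k o\<^sub>L (F k - (\<Sum>j<J. h j k)))"
        by (simp add: sum_eq algebra_simps)
      moreover have "norm (\<Sum>k. K m k o\<^sub>L (F k - (\<Sum>j<J. h j k))) \<le> M / (1 - q) * q ^ J * suminf a * w m"
        using tail_le by (rule norm_suminf_compose_le) (intro mult_nonneg_nonneg MC zero_le_power q)
      ultimately show ?thesis by (simp add: q_def mult_ac)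
    qed
    have "(\<lambda>J. q ^ J) \<longlonglongrightarrow> 0"
      using q by (rule LIMSEQ_realpow_zero)
    then have "(\<lambda>J. M / (1 - q) * q * w m * q ^ J) \<longlonglongrightarrow> 0"
      by (rule tendsto_mult_right_zero)
    then have "(\<lambda>J. (\<Sum>k. K m k o\<^sub>L F k) - (\<Sum>j<J. h (Suc j) m)) \<longlonglongrightarrow> 0"
      by (rule Lim_null_comparison[rotated]) (intro always_eventually allI le)
    then have "(\<lambda>j. h (Suc j) m) sums (\<Sum>k. K m k o\<^sub>L F k)"
      using tendsto_diff[OF tendsto_const[of "\<Sum>k. K m k o\<^sub>L F k"]] by (force simp: sums_def)
    then have "(\<Sum>k. K m k o\<^sub>L F k) = (\<Sum>j. h (Suc j) m)"
      by (rule sums_unique)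
    also have "\<dots> = F m - g m"
      unfolding F_def using suminf_split_head[OF h_summable, of m] by (simp only: h_0)
    finally show ?thesis
      by simp
  qed
  show thesis
    using F_le F_eq unfolding q_def by (rule that)
qed

end

section \<open>Green functions\<close>

text \<open>The two equations say that \<open>G\<close> is a right and a left inverse of the operator
  \<open>x \<mapsto> (\<lambda>m. x (Suc m) - A m (x m))\<close>. They do not mention the projections, which are recovered
  as the diagonal values \<open>G n n\<close>.\<close>

definition green_function ::
  "(nat \<Rightarrow> 'a::real_normed_vector \<Rightarrow>\<^sub>L 'a) \<Rightarrow> (nat \<Rightarrow> nat \<Rightarrow> 'a \<Rightarrow>\<^sub>L 'a) \<Rightarrow> bool" where
  "green_function A G \<longleftrightarrow>
     (\<forall>m n. G (Suc m) n = (A m o\<^sub>L G m n) + (if Suc m = n then id_blinfun else 0)) \<and>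
     (\<forall>m n. G m (Suc n) o\<^sub>L A n = G m n - (if m = n then id_blinfun else 0))"

lemma green_function_left:
  "green_function A G \<Longrightarrow>
    G (Suc m) n = (A m o\<^sub>L G m n) + (if Suc m = n then id_blinfun else 0)"
  by (simp add: green_function_def)

lemma green_function_right:
  "green_function A G \<Longrightarrow>
    G m (Suc n) o\<^sub>L A n = G m n - (if m = n then id_blinfun else 0)"
  by (simp add: green_function_def)

text \<open>Exponential decay in the distance of \<open>m\<close> and \<open>n\<close> on the time
  scale \<open>ln (\<mu> n)\<close>. Being symmetric, it covers both estimates of the dichotomy at
  once.\<close>

definition decay :: "(nat \<Rightarrow> real) \<Rightarrow> real \<Rightarrow> nat \<Rightarrow> nat \<Rightarrow> real" where
  "decay \<mu> b m n = exp (- b * \<bar>ln (\<mu> m) - ln (\<mu> n)\<bar>)"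

lemma decay_pos: "0 < decay \<mu> b m n"
  by (simp add: decay_def)

lemma decay_commute: "decay \<mu> b m n = decay \<mu> b n m"
  by (simp add: decay_def abs_minus_commute)

lemma decay_antimono: "b \<le> b' \<Longrightarrow> decay \<mu> b' m n \<le> decay \<mu> b m n"
  by (simp add: decay_def mult_right_mono)

text \<open>The triangle inequality on the time scale \<open>ln (\<mu> n)\<close>,
  exponentiated.\<close>

lemma decay_mult_le: "0 \<le> b \<Longrightarrow> decay \<mu> b m k * decay \<mu> b k n \<le> decay \<mu> b m n"
proof -
  assume "0 \<le> b"
  then have "b * \<bar>ln (\<mu> m) - ln (\<mu> n)\<bar>
      \<le> b * (\<bar>ln (\<mu> m) - ln (\<mu> k)\<bar> + \<bar>ln (\<mu> k) - ln (\<mu> n)\<bar>)"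
    by (intro mult_left_mono) auto
  then show ?thesis
    by (simp add: decay_def distrib_left flip: exp_add)
qed

lemma growth_rate_pos: "growth_rate \<mu> \<Longrightarrow> 0 < \<mu> n"
  by (simp add: growth_rate_def)

lemma growth_rate_mono: "growth_rate \<mu> \<Longrightarrow> n \<le> m \<Longrightarrow> \<mu> n \<le> \<mu> m"
  by (simp add: growth_rate_def strict_mono_less_eq)

lemma decay_eq_powr:
  assumes "growth_rate \<mu>" "n \<le> m"
  shows "decay \<mu> b m n = (\<mu> m / \<mu> n) powr (- b)"
proof -
  have pos: "0 < \<mu> n" "0 < \<mu> m"
    using assms(1) by (simp_all add: growth_rate_pos)
  then have "ln (\<mu> n) \<le> ln (\<mu> m)"
    using growth_rate_mono[OF assms] by simp
  with pos show ?thesis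
    by (simp add: decay_def powr_def ln_div)
qed

section \<open>Green functions and evolution operators\<close>

lemma evol_refl [simp]: "evol A n n = id_blinfun"
  by (cases n) auto

lemma evol_Suc_right:
  "n < m \<Longrightarrow> evol A m n = evol A m (Suc n) o\<^sub>L A n"
proof (induction m)
  case (Suc m)
  show ?case
  proof (cases "n = m")
    case True
    then show ?thesis by simp
  next
    case False
    then show ?thesis using Suc by (simp add: blinfun_compose_assoc)
  qed
qed simp

lemma green_function_eq_evol:
  assumes "green_function A G" "n \<le> m"
  shows "G m n = evol A m n o\<^sub>L G n n"
  using assms(2)
proof (induction m rule: dec_induct)
  case (step m)
  then show ?case
    using green_function_left[OF assms(1), of m n] by (simp add: blinfun_compose_assoc)
qed simp

lemma green_function_evol:
  assumes "green_function A G" "n \<le> m"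
  shows "G m m o\<^sub>L evol A m n = G m n"
  using assms(2)
proof (induction n rule: inc_induct)
  case (step n)
  then show ?case
    using green_function_right[OF assms(1), of m n]
    by (simp add: evol_Suc_right flip: blinfun_compose_assoc)
qed simp

text \<open>A column solves the homogeneous equation up to index \<open>n - 1\<close>; the last step
  crosses the jump on the diagonal, which accounts for \<open>- id_blinfun\<close>.\<close>

lemma evol_green_function:
  assumes "green_function A G" "m < n"
  shows "evol A n m o\<^sub>L G m n = G n n - id_blinfun"
proof -
  have "evol A k m o\<^sub>L G m n = G k n" if "m \<le> k" "k < n" for k
    using that
  proof (induction k rule: dec_induct)
    case (step k)
    then show ?case
      using green_function_left[OF assms(1), of k n] by (simp add: blinfun_compose_assoc)
  qed simp
  moreover obtain k where k: "n = Suc k" "m \<le> k"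
    using assms(2) by (metis less_imp_Suc_add le_add1)
  ultimately show ?thesis
    using green_function_left[OF assms(1), of k n] by (simp add: blinfun_compose_assoc)
qed

text \<open>The same argument along a row: the jump is met when the second index goes from
  \<open>Suc m\<close> to \<open>m\<close>.\<close>

lemma green_function_evol_back:
  assumes "green_function A G" "m < n"
  shows "G m n o\<^sub>L evol A n m = G m m - id_blinfun"
proof -
  have *: "G m n o\<^sub>L evol A n k = G m k" if "k \<le> n" "m < k" for k
    using that
  proof (induction k rule: inc_induct)
    case (step k)
    then show ?case
      using green_function_right[OF assms(1), of m k]
      by (simp add: evol_Suc_right flip: blinfun_compose_assoc)
  qed simp
  have "G m n o\<^sub>L evol A n m = (G m n o\<^sub>L evol A n (Suc m)) o\<^sub>L A m"
    using assms(2) by (simp add: evol_Suc_right blinfun_compose_assoc)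
  also have "\<dots> = G m m - id_blinfun"
    using *[of "Suc m"] green_function_right[OF assms(1), of m m] assms(2) by simp
  finally show ?thesis .
qed

lemma evol_bij_betw_ker:
  assumes "\<And>n. bij_betw (blinfun_apply (A n)) (ker (P n)) (ker (P (Suc n)))" "m \<le> n"
  shows "bij_betw (blinfun_apply (evol A n m)) (ker (P m)) (ker (P n))"
  using assms(2)
proof (induction n rule: dec_induct)
  case base
  then show ?case by (simp add: bij_betw_def inj_on_def)
next
  case (step n)
  then show ?case
    using bij_betw_trans[OF step.IH assms(1)] by (simp add: comp_def)
qed

text \<open>The last clause records that \<open>G 0 n\<close> maps into the kernel of the projection
  \<open>G 0 0\<close> for \<open>n > 0\<close>. It fixes the initial condition that later forces
  the perturbed projections to be idempotent.\<close>

lemma dichotomy_imp_green_function: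
  fixes A :: "nat \<Rightarrow> 'a::banach \<Rightarrow>\<^sub>L 'a"
  assumes \<mu>: "growth_rate \<mu>" and dich: "dichotomy_with_exponent \<mu> \<nu> A lam"
  obtains G D where "green_function A G" and "0 < D"
    and "\<And>m n. norm (G m n) \<le> D * \<nu> n * decay \<mu> lam m n"
    and "\<And>n. G 0 0 o\<^sub>L G 0 n = (if n = 0 then G 0 0 else 0)"
proof -
  obtain P D where proj: "\<And>n. P n o\<^sub>L P n = P n"
    and Pinv: "\<And>n. A n o\<^sub>L P n = P (Suc n) o\<^sub>L A n"
    and bij: "\<And>n. bij_betw (blinfun_apply (A n)) (ker (P n)) (ker (P (Suc n)))"
    and D: "D > 0"
    and fw: "\<And>m n. n \<le> m \<Longrightarrow> norm (evol A m n o\<^sub>L P n) \<le> D * \<nu> n * (\<mu> m / \<mu> n) powr (- lam)"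
    and bl: "\<And>m n. m \<le> n \<Longrightarrow> bounded_linear (\<lambda>x. evol_back A P m n (blinfun_apply (id_blinfun - P n) x))"
    and bw: "\<And>m n. m \<le> n \<Longrightarrow> onorm (\<lambda>x. evol_back A P m n (blinfun_apply (id_blinfun - P n) x))
                \<le> D * \<nu> n * (\<mu> n / \<mu> m) powr (- lam)"
    using dich unfolding dichotomy_with_exponent_def
    apply (elim conjE exE)
    subgoal premises p for P D
      by (rule p(1)[of P D]) (use p(3-) in \<open>blast+\<close>)
    done
  have projx: "P n (P n x) = P n x" for n x
    using proj[of n] by (metis blinfun_apply_blinfun_compose)
  have invx: "A n (P n x) = P (Suc n) (A n x)" for n x
    using Pinv[of n] by (metis blinfun_apply_blinfun_compose)
  \<comment> \<open>The backward evolution as a bounded operator. It is meaningful only for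
    \<open>m \<le> n\<close>, where boundedness is known.\<close>
  define U where "U m n = Blinfun (\<lambda>x. evol_back A P m n (blinfun_apply (id_blinfun - P n) x))" for m n
  have U_apply: "U m n x = evol_back A P m n (x - P n x)" if "m \<le> n" for m n x
    using bounded_linear_Blinfun_apply[OF bl[OF that]]
    by (simp add: U_def blinfun.diff_left)
  have inker: "x - P n x \<in> ker (P n)" for n x
    by (simp add: ker_def blinfun.diff_right projx)
  have U_ker: "U m n x \<in> ker (P m)" and evol_U: "evol A n m (U m n x) = x - P n x"
    if "m \<le> n" for m n x
  proof -
    have "x - P n x \<in> blinfun_apply (evol A n m) ` ker (P m)"
      using evol_bij_betw_ker[of A P m n, OF bij that] inker[of x n] by (simp add: bij_betw_def)
    then show "U m n x \<in> ker (P m)" "evol A n m (U m n x) = x - P n x"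
      unfolding U_apply[OF that] evol_back_def by (auto intro: inv_into_into f_inv_into_f)
  qed
  \<comment> \<open>Injectivity on the kernel characterizes \<open>U m n x\<close>, so identities
    for \<open>U\<close> can be checked after applying \<open>evol A n m\<close>.\<close>
  have U_eqI: "U m n x = y" if "m \<le> n" "y \<in> ker (P m)" "evol A n m y = x - P n x" for m n x y
    using evol_bij_betw_ker[of A P m n, OF bij that(1)] U_ker[OF that(1)] evol_U[OF that(1)] that
    by (auto simp: bij_betw_def inj_on_def)
  have U_refl: "U n n x = x - P n x" for n x
    by (rule U_eqI) (auto simp: inker)
  have A_U: "A m (U m n x) = U (Suc m) n x" if "m < n" for m n x
  proof (rule U_eqI[symmetric])
    show "A m (U m n x) \<in> ker (P (Suc m))"
      using bij[of m] U_ker[of m n x] that by (auto simp: bij_betw_def)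
    show "evol A n (Suc m) (A m (U m n x)) = x - P n x"
      using evol_U[of m n x] evol_Suc_right[OF that, of A] that by simp
  qed (use that in simp)
  have U_A: "U m (Suc n) (A n x) = U m n x" if "m \<le> n" for m n x
    by (rule U_eqI) (use that in \<open>auto simp: U_ker evol_U blinfun.diff_right invx\<close>)
  define G where "G m n = (if n \<le> m then evol A m n o\<^sub>L P n else - U m n)" for m n
  show thesis
  proof
    show "green_function A G"
      unfolding green_function_def
    proof (intro conjI allI)
      fix m n
      consider "n \<le> m" | "n = Suc m" | "Suc m < n" by linarith
      then show "G (Suc m) n = (A m o\<^sub>L G m n) + (if Suc m = n then id_blinfun else 0)"
      proof cases
        case 1
        then show ?thesis by (simp add: G_def blinfun_compose_assoc)
      next
        \<comment> \<open>Here \<open>A m\<close> turns \<open>- U m n\<close> into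
          \<open>- U n n = P n - id_blinfun\<close>, and the added identity gives
          \<open>P n = G n n\<close>.\<close>
        case 2
        then show ?thesis
          by (intro blinfun_eqI)
            (simp add: G_def A_U U_refl blinfun.add_left blinfun.minus_left blinfun.minus_right)
      next
        case 3
        then show ?thesis
          by (intro blinfun_eqI) (simp add: G_def A_U blinfun.minus_left blinfun.minus_right)
      qed
      consider "Suc n \<le> m" | "n = m" | "m < n" by linarith
      then show "G m (Suc n) o\<^sub>L A n = G m n - (if m = n then id_blinfun else 0)"
      proof cases
        case 1
        then show ?thesis
          by (simp add: G_def evol_Suc_right[of n m] blinfun_compose_assoc Pinv)
      next
        case 2
        then show ?thesis
          by (intro blinfun_eqI) (simp add: G_def U_A U_refl blinfun.diff_left blinfun.minus_left)
      next
        case 3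
        then show ?thesis
          by (intro blinfun_eqI) (simp add: G_def U_A blinfun.minus_left)
      qed
    qed
    show "D > 0" by (rule D)
    show "norm (G m n) \<le> D * \<nu> n * decay \<mu> lam m n" for m n
    proof (cases "n \<le> m")
      case True
      then show ?thesis using fw[OF True] by (simp add: G_def decay_eq_powr[OF \<mu>])
    next
      case False
      then have "m \<le> n" by simp
      have "norm (U m n) = onorm (\<lambda>x. evol_back A P m n (blinfun_apply (id_blinfun - P n) x))"
        using bounded_linear_Blinfun_apply[OF bl[OF \<open>m \<le> n\<close>]] by (simp add: norm_blinfun.rep_eq U_def)
      then show ?thesis
        using bw[OF \<open>m \<le> n\<close>] False
        by (simp add: G_def decay_commute[of \<mu> lam m n] decay_eq_powr[OF \<mu>])
    qed
    show "G 0 0 o\<^sub>L G 0 n = (if n = 0 then G 0 0 else 0)" for n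
      using U_ker[of 0 n] proj
      by (auto simp: G_def ker_def blinfun.minus_left blinfun.minus_right intro!: blinfun_eqI)
  qed
qed

text \<open>The diagonal values are the projections, and for \<open>m < n\<close> the operator
  \<open>- G m n\<close> inverts \<open>evol A n m\<close> between their kernels.\<close>

lemma green_function_imp_dichotomy:
  fixes A :: "nat \<Rightarrow> 'a::banach \<Rightarrow>\<^sub>L 'a"
  assumes \<mu>: "growth_rate \<mu>" and \<nu>: "\<And>n. 1 \<le> \<nu> n" and b: "0 < b" and D: "0 < D"
    and G: "green_function A G"
    and le: "\<And>m n. norm (G m n) \<le> D * \<nu> n * decay \<mu> b m n"
    and proj: "\<And>m n. G m n o\<^sub>L G n n = (if n \<le> m then G m n else 0)"
  shows "dichotomy_with_exponent \<mu> \<nu> A b"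
proof -
  define P where "P n = G n n" for n
  have PP: "P n o\<^sub>L P n = P n" for n
    using proj[of n n] by (simp add: P_def)
  \<comment> \<open>Both sides equal \<open>G (Suc n) n\<close>.\<close>
  have Pinv: "A n o\<^sub>L P n = P (Suc n) o\<^sub>L A n" for n
    using green_function_eq_evol[OF G, of n "Suc n"] green_function_evol[OF G, of n "Suc n"]
    by (simp add: P_def)
  have ker_iff: "x \<in> ker (P n) \<longleftrightarrow> P n x = 0" for x n
    by (simp add: ker_def)
  have GA: "G m n (evol A n m x) = P m x - x" and AG: "evol A n m (G m n x) = P n x - x"
    if "m < n" for m n x
    using arg_cong[OF green_function_evol_back[OF G that], of "\<lambda>f. blinfun_apply f x"]
      arg_cong[OF evol_green_function[OF G that], of "\<lambda>f. blinfun_apply f x"]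
    by (simp_all add: P_def blinfun.diff_left)
  have GP: "G m n (P n x) = 0" if "m < n" for m n x
    using arg_cong[OF proj[of m n], of "\<lambda>f. blinfun_apply f x"] that by (simp add: P_def)
  \<comment> \<open>Since \<open>G m n\<close> kills the range of \<open>P n\<close>, it sees only
    \<open>x - P n x\<close>, which is \<open>- evol A n m (G m n x)\<close>; \<open>GA\<close> then
    evaluates the composition.\<close>
  have PG: "P m (G m n x) = 0" if "m < n" for m n x
  proof -
    have "G m n x = G m n (x - P n x)"
      using GP[OF that] by (simp add: blinfun.diff_right)
    also have "\<dots> = - G m n (evol A n m (G m n x))"
      using AG[OF that] by (simp add: blinfun.diff_right)
    also have "\<dots> = G m n x - P m (G m n x)"
      using GA[OF that] by simp
    finally show ?thesis by simp
  qed
  have bij: "bij_betw (blinfun_apply (evol A n m)) (ker (P m)) (ker (P n))" if "m < n" for m n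
  proof (rule bij_betwI[where g = "blinfun_apply (- G m n)"])
    have "P n (evol A n m x) = evol A n m (P m x)" for x
      using green_function_eq_evol[OF G, of m n] green_function_evol[OF G, of m n] that
      by (metis P_def blinfun_apply_blinfun_compose less_imp_le)
    then show "blinfun_apply (evol A n m) \<in> ker (P m) \<rightarrow> ker (P n)"
      by (auto simp: ker_iff)
    show "blinfun_apply (- G m n) \<in> ker (P n) \<rightarrow> ker (P m)"
      using PG[OF that] by (auto simp: ker_iff blinfun.minus_left blinfun.minus_right)
  qed (use GA[OF that] AG[OF that] in \<open>auto simp: ker_iff blinfun.minus_left blinfun.minus_right\<close>)
  \<comment> \<open>The diagonal is a separate case, because there \<open>- G n n\<close> is
    \<open>- P n\<close> and lacks the identity contributed by the jump.\<close>
  have back_eq: "(\<lambda>x. evol_back A P m n (blinfun_apply (id_blinfun - P n) x))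
      = blinfun_apply (if m = n then id_blinfun - P n else - G m n)" if "m \<le> n" for m n
  proof
    fix x
    have x: "(id_blinfun - P n) x \<in> ker (P n)"
      using arg_cong[OF PP[of n], of "\<lambda>f. blinfun_apply f x"]
      by (simp add: ker_iff blinfun.diff_left blinfun.diff_right)
    show "evol_back A P m n ((id_blinfun - P n) x) = (if m = n then id_blinfun - P n else - G m n) x"
    proof (cases "m = n")
      case True
      then show ?thesis
        unfolding evol_back_def using x by (simp add: inv_into_f_eq inj_on_def)
    next
      case False
      then have "m < n" using that by simp
      show ?thesis
        unfolding evol_back_def
        using bij[OF \<open>m < n\<close>] PG[OF \<open>m < n\<close>] AG[OF \<open>m < n\<close>] False
        by (intro inv_into_f_eq)
          (auto simp: bij_betw_def ker_iff blinfun.minus_left blinfun.minus_right blinfun.diff_left)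
    qed
  qed
  have D_le: "D * \<nu> n * decay \<mu> b m n \<le> (D + 1) * \<nu> n * decay \<mu> b m n" for m n
    using \<nu>[of n] decay_pos[of \<mu> b m n] by (intro mult_right_mono) auto
  show ?thesis
    unfolding dichotomy_with_exponent_def
  \<comment> \<open>The extra \<open>1\<close> in \<open>D + 1\<close> absorbs the norm of the
    identity in \<open>id_blinfun - P n\<close>, using \<open>1 \<le> \<nu> n\<close>.\<close>
  proof (intro conjI exI[of _ P] exI[of _ "D + 1"] allI impI)
    fix m n :: nat
    show "bij_betw (blinfun_apply (A n)) (ker (P n)) (ker (P (Suc n)))"
      using bij[of n "Suc n"] by simp
    show "norm (evol A m n o\<^sub>L P n) \<le> (D + 1) * \<nu> n * (\<mu> m / \<mu> n) powr (- b)" if "n \<le> m"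
      using order_trans[OF le D_le, of m n] that
      by (simp add: P_def decay_eq_powr[OF \<mu>] flip: green_function_eq_evol[OF G])
    assume mn: "m \<le> n"
    show "bounded_linear (\<lambda>x. evol_back A P m n (blinfun_apply (id_blinfun - P n) x))"
      unfolding back_eq[OF mn] by (rule blinfun.bounded_linear_right)
    have "norm (if m = n then id_blinfun - P n else - G m n) \<le> (D + 1) * \<nu> n * decay \<mu> b m n"
    proof (cases "m = n")
      case True
      have "norm (id_blinfun - P n) \<le> 1 + D * \<nu> n"
        using norm_triangle_ineq4[of id_blinfun "P n"] norm_blinfun_id_le[where 'a='a] le[of n n]
        by (simp add: P_def decay_def)
      also have "\<dots> \<le> (D + 1) * \<nu> n"
        using \<nu>[of n] by (simp add: algebra_simps)
      finally show ?thesis using True by (simp add: decay_def)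
    next
      case False
      then show ?thesis using order_trans[OF le D_le, of m n] by simp
    qed
    then show "onorm (\<lambda>x. evol_back A P m n (blinfun_apply (id_blinfun - P n) x))
        \<le> (D + 1) * \<nu> n * (\<mu> n / \<mu> m) powr (- b)"
      unfolding back_eq[OF mn] by (simp add: norm_blinfun.rep_eq decay_commute[of \<mu> b m n] decay_eq_powr[OF \<mu> mn])
  qed (use PP Pinv b D in auto)
qed


section \<open>Perturbation of Green functions\<close>

lemma decay_le_1: "0 \<le> b \<Longrightarrow> decay \<mu> b m n \<le> 1"
  by (simp add: decay_def)

text \<open>The fixed-point equation is solved separately for each column \<open>n\<close>, with
  contraction constant \<open>D * suminf \<delta>\<close>. The hypotheses \<open>G_0\<close> and
  \<open>lim\<close> enter in the proof of idempotency.\<close>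

lemma perturbed_green_function:
  fixes A B :: "nat \<Rightarrow> 'a::banach \<Rightarrow>\<^sub>L 'a"
  assumes G: "green_function A G" and D: "0 < D" and \<nu>: "\<And>n. 0 \<le> \<nu> n"
    and G_le: "\<And>m n. norm (G m n) \<le> D * \<nu> n * decay \<mu> lam m n"
    and G_0: "\<And>n. G 0 0 o\<^sub>L G 0 n = (if n = 0 then G 0 0 else 0)"
    and lim: "\<And>m. (\<lambda>n. \<nu> n * decay \<mu> lam m n) \<longlonglongrightarrow> 0"
    and b: "0 \<le> b" "b \<le> lam"
    and B_le: "\<And>k. \<nu> (Suc k) * norm (B k) \<le> \<delta> k * decay \<mu> b (Suc k) k"
    and \<delta>: "summable \<delta>" "D * suminf \<delta> < 1"
  obtains G' D' where "green_function (\<lambda>n. A n + B n) G'" and "0 < D'"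
    and "\<And>m n. norm (G' m n) \<le> D' * \<nu> n * decay \<mu> b m n"
    and "\<And>m n. G' m n o\<^sub>L G' n n = (if n \<le> m then G' m n else 0)"
proof -
  define K where "K m k = G m (Suc k) o\<^sub>L B k" for m k
  have \<delta>_nonneg: "0 \<le> \<delta> k" for k
  proof -
    have "0 \<le> \<delta> k * decay \<mu> b (Suc k) k"
      by (rule order_trans[OF _ B_le]) (simp add: \<nu>)
    then show ?thesis
      using decay_pos[of \<mu> b "Suc k" k] by (simp add: zero_le_mult_iff)
  qed
  \<comment> \<open>Kernel and bound are common to all columns; only the weight depends on
    \<open>n\<close>.\<close>
  interpret summable_kernel K "\<lambda>m. decay \<mu> b m n" "\<lambda>k. D * \<delta> k" for n
  proof
    fix m k
    have "norm (K m k) \<le> norm (G m (Suc k)) * norm (B k)"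
      unfolding K_def by (rule norm_blinfun_compose)
    also have "\<dots> \<le> (D * \<nu> (Suc k) * decay \<mu> lam m (Suc k)) * norm (B k)"
      by (intro mult_right_mono G_le) simp
    also have "\<dots> = D * decay \<mu> lam m (Suc k) * (\<nu> (Suc k) * norm (B k))"
      by simp
    also have "\<dots> \<le> D * decay \<mu> b m (Suc k) * (\<delta> k * decay \<mu> b (Suc k) k)"
      using D \<nu>[of "Suc k"] decay_pos[of \<mu> b m "Suc k"] b
      by (intro mult_mono[OF _ B_le] mult_left_mono decay_antimono) auto
    finally have "norm (K m k) * decay \<mu> b k n
        \<le> D * decay \<mu> b m (Suc k) * (\<delta> k * decay \<mu> b (Suc k) k) * decay \<mu> b k n"
      using decay_pos[of \<mu> b k n] by (intro mult_right_mono) auto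
    also have "\<dots> = D * \<delta> k * (decay \<mu> b m (Suc k) * (decay \<mu> b (Suc k) k * decay \<mu> b k n))"
      by simp
    also have "\<dots> \<le> D * \<delta> k * (decay \<mu> b m (Suc k) * decay \<mu> b (Suc k) n)"
      using D \<delta>_nonneg[of k] decay_pos[of \<mu> b m "Suc k"]
      by (intro mult_left_mono decay_mult_le b) auto
    also have "\<dots> \<le> D * \<delta> k * decay \<mu> b m n"
      using D \<delta>_nonneg[of k] by (intro mult_left_mono decay_mult_le b) auto
    finally show "norm (K m k) * decay \<mu> b k n \<le> D * \<delta> k * decay \<mu> b m n" .
  next
    show "summable (\<lambda>k. D * \<delta> k)"
      using \<delta>(1) by (rule summable_mult)
    show "(\<Sum>k. D * \<delta> k) < 1"
      using \<delta> by (simp add: suminf_mult)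
  qed (rule decay_pos)
  define D' where "D' = D / (1 - (\<Sum>k. D * \<delta> k))"
  have D': "0 < D'"
    using D suminf_a by (simp add: D'_def)
  have "\<forall>n. \<exists>F. (\<forall>m. norm (F m) \<le> D' * \<nu> n * decay \<mu> b m n) \<and>
      (\<forall>m. F m = G m n + (\<Sum>k. K m k o\<^sub>L F k))"
  proof
    fix n
    have "norm (G m n) \<le> D * \<nu> n * decay \<mu> b m n" for m
      by (rule order_trans[OF G_le]) (use D \<nu>[of n] in \<open>intro mult_left_mono decay_antimono b, auto\<close>)
    then show "\<exists>F. (\<forall>m. norm (F m) \<le> D' * \<nu> n * decay \<mu> b m n) \<and>
      (\<forall>m. F m = G m n + (\<Sum>k. K m k o\<^sub>L F k))"
    proof (rule fixed_point_exists)
      fix F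
      assume le: "\<And>m. norm (F m) \<le> D * \<nu> n / (1 - (\<Sum>k. D * \<delta> k)) * decay \<mu> b m n"
        and *: "\<And>m. F m = G m n + (\<Sum>k. K m k o\<^sub>L F k)"
      have "norm (F m) \<le> D' * \<nu> n * decay \<mu> b m n" for m
        using le[of m] by (simp add: D'_def)
      with * show ?thesis
        by (intro exI[of _ F] conjI allI)
    qed
  qed
  from choice[OF this] obtain F where F: "\<forall>n. (\<forall>m. norm (F n m) \<le> D' * \<nu> n * decay \<mu> b m n) \<and>
      (\<forall>m. F n m = G m n + (\<Sum>k. K m k o\<^sub>L F n k))"
    by (elim exE)
  define G' where "G' m n = F n m" for m n
  have G'_le: "norm (G' m n) \<le> D' * \<nu> n * decay \<mu> b m n" for m n
    unfolding G'_def by (rule F[THEN spec, THEN conjunct1, THEN spec])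
  have G'_eq: "G' m n = G m n + (\<Sum>k. K m k o\<^sub>L G' k n)" for m n
    unfolding G'_def by (rule F[THEN spec, THEN conjunct2, THEN spec])
  have D'\<nu>: "0 \<le> D' * \<nu> n" for n
    using D' \<nu> by simp
  have sm: "summable (\<lambda>k. K m k o\<^sub>L G' k n)" for m n
    using G'_le D'\<nu> by (rule summable_compose)
  have left: "G' (Suc m) n = ((A m + B m) o\<^sub>L G' m n) + (if Suc m = n then id_blinfun else 0)" for m n
  proof -
    \<comment> \<open>\<open>K m k\<close> contains column \<open>Suc k\<close> of \<open>G\<close>,
      so its jump occurs at \<open>k = m\<close> and produces exactly the perturbation term
      \<open>B m\<close>.\<close>
    have K_Suc: "K (Suc m) k o\<^sub>L G' k n
        = (A m o\<^sub>L (K m k o\<^sub>L G' k n)) + (if k = m then B k o\<^sub>L G' k n else 0)" for k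
      by (simp add: K_def green_function_left[OF G, of m] blinfun_compose_bilinear blinfun_compose_assoc)
    have "(\<lambda>k. (A m o\<^sub>L (K m k o\<^sub>L G' k n)) + (if k = m then B k o\<^sub>L G' k n else 0))
        sums ((A m o\<^sub>L (\<Sum>k. K m k o\<^sub>L G' k n)) + (B m o\<^sub>L G' m n))"
      by (intro sums_add sums_single bounded_linear.sums[OF bounded_linear_compose_right] summable_sums sm)
    then have "(\<Sum>k. K (Suc m) k o\<^sub>L G' k n)
        = (A m o\<^sub>L (\<Sum>k. K m k o\<^sub>L G' k n)) + (B m o\<^sub>L G' m n)"
      unfolding K_Suc by (rule sums_unique[symmetric])
    moreover have "A m o\<^sub>L G' m n = (A m o\<^sub>L G m n) + (A m o\<^sub>L (\<Sum>k. K m k o\<^sub>L G' k n))"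
      by (subst G'_eq) (simp add: blinfun_compose_bilinear)
    ultimately show ?thesis
      by (simp add: G'_eq[of "Suc m"] green_function_left[OF G, of m] blinfun_compose_bilinear)
  qed
  have right: "G' m (Suc n) o\<^sub>L (A n + B n) = G' m n - (if m = n then id_blinfun else 0)" for m n
  proof -
    \<comment> \<open>The defect of the right equation is a fixed point of the kernel: the jump of
      \<open>G\<close> leaves \<open>K m n\<close>, which is the kernel applied to the identity in
      \<open>H n\<close>. Uniqueness makes it vanish.\<close>
    define H where "H m = (G' m (Suc n) o\<^sub>L (A n + B n)) - G' m n + (if m = n then id_blinfun else 0)" for m
    \<comment> \<open>Dividing by \<open>decay \<mu> b (Suc n) n\<close> is the cost of moving the
      weight from column \<open>Suc n\<close> to column \<open>n\<close>; the final \<open>1\<close>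
      bounds the identity at \<open>m = n\<close>.\<close>
    define C where "C = D' * \<nu> (Suc n) / decay \<mu> b (Suc n) n * norm (A n + B n) + D' * \<nu> n + 1"
    have H_le: "norm (H m) \<le> C * decay \<mu> b m n" for m
    proof -
      have "decay \<mu> b m (Suc n) \<le> decay \<mu> b m n / decay \<mu> b (Suc n) n"
        using decay_mult_le[OF b(1), of \<mu> m "Suc n" n] decay_pos[of \<mu> b "Suc n" n]
        by (simp add: field_simps)
      then have "D' * \<nu> (Suc n) * decay \<mu> b m (Suc n)
          \<le> D' * \<nu> (Suc n) * (decay \<mu> b m n / decay \<mu> b (Suc n) n)"
        by (intro mult_left_mono D'\<nu>)
      then have "norm (G' m (Suc n)) \<le> D' * \<nu> (Suc n) * (decay \<mu> b m n / decay \<mu> b (Suc n) n)"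
        using G'_le[of m "Suc n"] by linarith
      then have 1: "norm (G' m (Suc n) o\<^sub>L (A n + B n))
          \<le> D' * \<nu> (Suc n) * (decay \<mu> b m n / decay \<mu> b (Suc n) n) * norm (A n + B n)"
        by (intro order_trans[OF norm_blinfun_compose] mult_right_mono) auto
      have 2: "norm (if m = n then id_blinfun else 0 :: 'a \<Rightarrow>\<^sub>L 'a) \<le> decay \<mu> b m n"
        using decay_pos[of \<mu> b m n] by (auto simp: norm_blinfun_id_le decay_def)
      have "norm (H m) \<le> norm (G' m (Suc n) o\<^sub>L (A n + B n)) + norm (G' m n)
          + norm (if m = n then id_blinfun else 0 :: 'a \<Rightarrow>\<^sub>L 'a)"
        unfolding H_def by (meson add_right_mono norm_triangle_ineq norm_triangle_ineq4 order_trans)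
      also have "\<dots> \<le> C * decay \<mu> b m n"
        using 1 2 G'_le[of m n] by (simp add: C_def algebra_simps)
      finally show ?thesis .
    qed
    have H_eq: "H m = (\<Sum>k. K m k o\<^sub>L H k)" for m
    proof -
      have K_H: "K m k o\<^sub>L H k = ((K m k o\<^sub>L G' k (Suc n)) o\<^sub>L (A n + B n)) - (K m k o\<^sub>L G' k n)
          + (if k = n then K m k else 0)" for k
        by (simp add: H_def blinfun_compose_bilinear blinfun_compose_assoc)
      have "(\<lambda>k. K m k o\<^sub>L H k) sums
          (((\<Sum>k. K m k o\<^sub>L G' k (Suc n)) o\<^sub>L (A n + B n)) - (\<Sum>k. K m k o\<^sub>L G' k n) + K m n)"
        unfolding K_H
        by (intro sums_add sums_diff sums_single bounded_linear.sums[OF bounded_linear_compose_left]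
            summable_sums sm)
      moreover have "((\<Sum>k. K m k o\<^sub>L G' k (Suc n)) o\<^sub>L (A n + B n)) - (\<Sum>k. K m k o\<^sub>L G' k n) + K m n = H m"
        using green_function_right[OF G, of m n]
        by (simp add: H_def G'_eq[of m] K_def blinfun_compose_bilinear)
      ultimately show ?thesis
        using sums_unique by metis
    qed
    have "H m = 0"
      using H_le H_eq by (rule fixed_point_eq_0)
    then show ?thesis
      by (simp add: H_def algebra_simps add_eq_0_iff)
  qed
  have green: "green_function (\<lambda>n. A n + B n) G'"
    unfolding green_function_def using left right by blast
  have G'_0: "G 0 0 o\<^sub>L G' 0 n = (if n = 0 then G 0 0 else 0)" for n
  proof -
    \<comment> \<open>\<open>K 0 k\<close> begins with \<open>G 0 (Suc k)\<close>, whose column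
      index is positive, so \<open>G_0\<close> applies.\<close>
    have "G 0 0 o\<^sub>L (K 0 k o\<^sub>L G' k n) = 0" for k
      by (simp add: K_def G_0 flip: blinfun_compose_assoc)
    then have "G 0 0 o\<^sub>L (\<Sum>k. K 0 k o\<^sub>L G' k n) = 0"
      by (simp add: bounded_linear.suminf[OF bounded_linear_compose_right sm])
    then show ?thesis
      by (subst G'_eq) (simp add: blinfun_compose_bilinear G_0)
  qed
  have proj: "G' m n o\<^sub>L G' n n = (if n \<le> m then G' m n else 0)" for m n
  proof -
    define H where "H m = (G' m n o\<^sub>L G' n n) - (if n \<le> m then G' m n else 0)" for m
    define C where "C = D' * \<nu> n * norm (G' n n) + D' * \<nu> n"
    have C: "0 \<le> C"
      by (simp add: C_def D'\<nu>)
    have H_le: "norm (H m) \<le> C * decay \<mu> b m n" for m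
    proof -
      have "norm (H m) \<le> norm (G' m n o\<^sub>L G' n n) + norm (if n \<le> m then G' m n else 0)"
        unfolding H_def by (rule norm_triangle_ineq4)
      also have "\<dots> \<le> norm (G' m n) * norm (G' n n) + norm (G' m n)"
        by (intro add_mono norm_blinfun_compose) simp
      also have "\<dots> \<le> D' * \<nu> n * decay \<mu> b m n * norm (G' n n) + D' * \<nu> n * decay \<mu> b m n"
        by (intro add_mono mult_right_mono G'_le) simp
      finally show ?thesis
        by (simp add: C_def algebra_simps)
    qed
    \<comment> \<open>At \<open>Suc m = n\<close> the jump contributes \<open>G' n n\<close>, and
      the subtracted term, which starts at that index, cancels it.\<close>
    have H_Suc: "H (Suc m) = (A m + B m) o\<^sub>L H m" for m
      by (auto simp: H_def left[of m] blinfun_compose_bilinear blinfun_compose_assoc not_less_eq_eq)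
    \<comment> \<open>For \<open>n = 0\<close> both terms of \<open>H 0\<close> become
      \<open>G 0 0\<close>; for \<open>n > 0\<close> both become \<open>0\<close>.\<close>
    have H_0: "G 0 0 o\<^sub>L H 0 = 0"
      by (simp add: H_def blinfun_compose_bilinear G'_0 flip: blinfun_compose_assoc)
    have H_eq: "H m = (\<Sum>k. K m k o\<^sub>L H k)" for m
    proof -
      \<comment> \<open>Summation by parts: the kernel series telescopes in \<open>X\<close>, apart
        from the jump at \<open>k = m\<close>, which yields \<open>H m\<close>. The boundary terms
        vanish by \<open>H_0\<close> at index \<open>0\<close> and by \<open>lim\<close> at
        infinity.\<close>
      define X where "X k = G m k o\<^sub>L H k" for k
      have X_0: "X 0 = 0"
        using green_function_eq_evol[OF G, of 0 m] H_0 by (simp add: X_def blinfun_compose_assoc)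
      have X_le: "norm (X k) \<le> D * C * (\<nu> k * decay \<mu> lam m k)" for k
      proof -
        have "norm (H k) \<le> C * 1"
          by (rule order_trans[OF H_le]) (intro mult_left_mono decay_le_1 b C)
        then have "norm (X k) \<le> (D * \<nu> k * decay \<mu> lam m k) * (C * 1)"
          unfolding X_def using D \<nu>[of k] decay_pos[of \<mu> lam m k]
          by (intro order_trans[OF norm_blinfun_compose] mult_mono G_le) auto
        then show ?thesis by (simp add: mult_ac)
      qed
      have "(\<lambda>k. D * C * (\<nu> k * decay \<mu> lam m k)) \<longlonglongrightarrow> D * C * 0"
        by (intro tendsto_mult tendsto_const lim)
      then have X: "X \<longlonglongrightarrow> 0"
        using X_le by (intro Lim_null_comparison[of X]) auto
      have "K m k o\<^sub>L H k = (X (Suc k) - X k) + (if k = m then H k else 0)" for k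
      proof -
        have "K m k o\<^sub>L H k = G m (Suc k) o\<^sub>L (H (Suc k) - (A k o\<^sub>L H k))"
          by (simp add: K_def H_Suc blinfun_compose_bilinear blinfun_compose_assoc)
        also have "\<dots> = X (Suc k) - ((G m (Suc k) o\<^sub>L A k) o\<^sub>L H k)"
          by (simp add: X_def blinfun_compose_bilinear blinfun_compose_assoc)
        also have "\<dots> = (X (Suc k) - X k) + (if k = m then H k else 0)"
          by (simp add: green_function_right[OF G] X_def blinfun_compose_bilinear)
        finally show ?thesis .
      qed
      moreover have "(\<lambda>k. (X (Suc k) - X k) + (if k = m then H k else 0)) sums ((0 - X 0) + H m)"
        by (intro sums_add telescope_sums X sums_single)
      ultimately show ?thesis
        using X_0 by (simp add: sums_iff)
    qed
    have "H m = 0"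
      using H_le H_eq by (rule fixed_point_eq_0)
    then show ?thesis
      by (simp add: H_def)
  qed
  show thesis
    using that green D' G'_le proj by blast
qed

text \<open>For \<open>n \<ge> m\<close> the product is at most a constant times
  \<open>\<mu> n powr (\<epsilon> - lam)\<close>, and this exponent is negative.\<close>

lemma tendsto_mult_decay_0:
  assumes \<mu>: "growth_rate \<mu>" and \<nu>: "\<And>n. 0 \<le> \<nu> n" and "\<epsilon> < lam"
    and bdd: "bdd_above (range (\<lambda>n. \<mu> n powr (- \<epsilon>) * \<nu> n))"
  shows "(\<lambda>n. \<nu> n * decay \<mu> lam m n) \<longlonglongrightarrow> 0"
proof -
  obtain M where M: "\<And>n. \<mu> n powr (- \<epsilon>) * \<nu> n \<le> M"
    using bdd by (auto simp: bdd_above_def)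
  have le: "norm (\<nu> n * decay \<mu> lam m n) \<le> M * \<mu> m powr lam * \<mu> n powr (\<epsilon> - lam)" if "m \<le> n" for n
  proof -
    have pos: "0 < \<mu> n" "0 < \<mu> m"
      using growth_rate_pos[OF \<mu>] by auto
    have "\<nu> n * decay \<mu> lam m n = (\<mu> n powr (- \<epsilon>) * \<nu> n) * (\<mu> m powr lam * \<mu> n powr (\<epsilon> - lam))"
      using pos decay_eq_powr[OF \<mu> that, of lam] decay_commute[of \<mu> lam m n]
      by (simp add: powr_divide powr_minus powr_diff field_simps)
    also have "\<dots> \<le> M * (\<mu> m powr lam * \<mu> n powr (\<epsilon> - lam))"
      by (intro mult_right_mono M) simp
    finally show ?thesis
      using \<nu>[of n] decay_pos[of \<mu> lam m n] by (simp add: mult_ac)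
  qed
  have "(\<lambda>n. \<mu> n powr (\<epsilon> - lam)) \<longlonglongrightarrow> 0"
    using \<mu> \<open>\<epsilon> < lam\<close> by (intro tendsto_neg_powr) (auto simp: growth_rate_def)
  then have "(\<lambda>n. M * \<mu> m powr lam * \<mu> n powr (\<epsilon> - lam)) \<longlonglongrightarrow> 0"
    by (rule tendsto_mult_right_zero)
  then show ?thesis
    by (rule Lim_null_comparison[rotated]) (rule eventually_sequentiallyI[OF le])
qed

theorem theorem3p12:
  fixes A :: "nat \<Rightarrow> 'a::banach \<Rightarrow>\<^sub>L 'a"
    and \<mu> \<nu> \<gamma> :: "nat \<Rightarrow> real"
    and lam \<epsilon> \<beta> :: real
  assumes "growth_rate \<mu>"
    and "\<And>n. 1 \<le> \<nu> n"
    and "\<And>n. 0 < \<gamma> n"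
    and "summable \<gamma>"
    and "dichotomy_with_exponent \<mu> \<nu> A lam"
    and "0 \<le> \<epsilon>" and "\<epsilon> < lam"
    and "bdd_above (range (\<lambda>n. \<mu> n powr (- \<epsilon>) * \<nu> n))"
    and "0 < \<beta>" and "\<beta> < lam - \<epsilon>"
  shows "\<exists>c\<^sub>0>0. \<forall>c. 0 < c \<and> c \<le> c\<^sub>0 \<longrightarrow>
           (\<forall>B :: nat \<Rightarrow> 'a \<Rightarrow>\<^sub>L 'a.
              (\<forall>n. norm (B n) \<le> c * \<gamma> n * \<mu> n powr \<beta> / (\<nu> (Suc n) * \<mu> (Suc n) powr \<beta>)) \<longrightarrow>
              admits_dichotomy \<mu> \<nu> (\<lambda>n. A n + B n))"
proof -
  have \<nu>: "0 \<le> \<nu> n" for n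
    using assms(2)[of n] by simp
  obtain G D where G: "green_function A G" and D: "0 < D"
    and G_le: "\<And>m n. norm (G m n) \<le> D * \<nu> n * decay \<mu> lam m n"
    and G_0: "\<And>n. G 0 0 o\<^sub>L G 0 n = (if n = 0 then G 0 0 else 0)"
    using dichotomy_imp_green_function[OF assms(1,5)] by blast
  have \<gamma>: "0 \<le> suminf \<gamma>"
    using assms(3,4) by (intro suminf_nonneg) (auto intro: less_imp_le)
  show ?thesis
  \<comment> \<open>This choice gives \<open>D * c * suminf \<gamma> < c * D * (suminf \<gamma> + 1)
    \<le> 1\<close>; the added \<open>1\<close> makes the contraction constant strictly less than
    \<open>1\<close>.\<close>
  proof (intro exI[of _ "1 / (D * (suminf \<gamma> + 1))"] conjI allI impI)
    show "0 < 1 / (D * (suminf \<gamma> + 1))"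
      using D \<gamma> by simp
    fix c and B :: "nat \<Rightarrow> 'a \<Rightarrow>\<^sub>L 'a"
    assume c: "0 < c \<and> c \<le> 1 / (D * (suminf \<gamma> + 1))"
      and B: "\<forall>n. norm (B n) \<le> c * \<gamma> n * \<mu> n powr \<beta> / (\<nu> (Suc n) * \<mu> (Suc n) powr \<beta>)"
    have "\<nu> (Suc k) * norm (B k) \<le> c * \<gamma> k * decay \<mu> \<beta> (Suc k) k" for k
    proof -
      have pos: "0 < \<mu> k" "0 < \<mu> (Suc k)" "0 < \<nu> (Suc k)"
        using growth_rate_pos[OF assms(1)] assms(2)[of "Suc k"] by auto
      then have "\<nu> (Suc k) * norm (B k) \<le> c * \<gamma> k * \<mu> k powr \<beta> / \<mu> (Suc k) powr \<beta>"
        using B[rule_format, of k] by (simp add: field_simps)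
      also have "\<dots> = c * \<gamma> k * decay \<mu> \<beta> (Suc k) k"
        using pos decay_eq_powr[OF assms(1), of k "Suc k" \<beta>]
        by (simp add: powr_divide powr_minus field_simps)
      finally show ?thesis .
    qed
    moreover have "summable (\<lambda>k. c * \<gamma> k)"
      using assms(4) by (rule summable_mult)
    moreover have "D * (\<Sum>k. c * \<gamma> k) < 1"
    proof -
      have "D * (\<Sum>k. c * \<gamma> k) < c * (D * (suminf \<gamma> + 1))"
        using c D by (simp add: suminf_mult[OF assms(4)] algebra_simps)
      also have "\<dots> \<le> 1"
        using c D \<gamma> by (simp add: pos_le_divide_eq add_pos_nonneg)
      finally show ?thesis .
    qed
    \<comment> \<open>The decay rate is \<open>\<beta>\<close>; it is at most \<open>lam\<close>
      because \<open>\<beta> < lam - \<epsilon>\<close> and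
      \<open>0 \<le> \<epsilon>\<close>.\<close>
    ultimately obtain G' D' where "green_function (\<lambda>n. A n + B n) G'" "0 < D'"
      "\<And>m n. norm (G' m n) \<le> D' * \<nu> n * decay \<mu> \<beta> m n"
      "\<And>m n. G' m n o\<^sub>L G' n n = (if n \<le> m then G' m n else 0)"
      using perturbed_green_function[OF G D \<nu> G_le G_0 tendsto_mult_decay_0[OF assms(1) \<nu> assms(7,8)],
          of \<beta> B "\<lambda>k. c * \<gamma> k"] assms(6,9,10) by auto
    then have "dichotomy_with_exponent \<mu> \<nu> (\<lambda>n. A n + B n) \<beta>"
      using assms(1,2,9) by (intro green_function_imp_dichotomy)
    then show "admits_dichotomy \<mu> \<nu> (\<lambda>n. A n + B n)"
      by (auto simp: admits_dichotomy_def)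
  qed
qed

end
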